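(* Let $H$ be a quasi-triangular bialgebra with an R-matrix $R$, and let $R^{(1)}=R$, $R^{(-1)}=R_{2,1}^{-1}$. Suppose that $\boldsymbol a=(a_{i,j})_{1\le i,j\le n}$, $a_{i,j}\in\{1,-1\}$, is transitive and satisfies $a_{j,i}=-a_{i,j}$ for all $1\le i<j\le n$. Then $$\mathbf R^{(\boldsymbol a)}=\big(R_{1,2n}^{(a_{n,1})}\cdots R_{n,2n}^{(a_{n,n})}\big)\big(R_{1,2n-1}^{(a_{n-1,1})}\cdots R_{n,2n-1}^{(a_{n-1,n})}\big)\cdots\big(R_{1,n+1}^{(a_{1,1})}\cdots R_{n,n+1}^{(a_{1,n})}\big)\in H^{\widehat\otimes2n}$$ solves the quantum Yang-Baxter equation, as an element of $H^{\otimes n}\widehat\otimes H^{\otimes n}$.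
   Context: Algebras are unital associative over a field of characteristic zero. $H^{\widehat\otimes m}$ denotes $H^{\otimes m}$ or a suitable completion: an algebra containing $H^{\otimes m}$ such that leg embeddings, permutations of factors, and comultiplication or counit applied to a factor extend to these algebras as algebra homomorphisms, with the usual identities among them (coassociativity, counit axioms, commutation of elements placed in disjoint legs) preserved. For $X\in H\widehat\otimes H$ and distinct $i,j$, $X_{i,j}$ has the first factor of $X$ in position $i$, the second in position $j$ and $1$ elsewhere. An R-matrix for a bialgebra $(H,\Delta)$ is an invertible $R\in H\widehat\otimes H$ with $\tau(\Delta(h))=R\Delta(h)R^{-1}$ for all $h\in H$ ($\tau$ the flip), $(\Delta\otimes\mathrm{id})(R)=R_{1,3}R_{2,3}$ and $(\mathrm{id}\otimes\Delta)(R)=R_{1,3}R_{1,2}$; $H$ is quasi-triangular if it has one. For an algebra $K$, $X\in K\widehat\otimes K$ solves the quantum Yang-Baxter equation if $X_{1,2}X_{1,3}X_{2,3}=X_{2,3}X_{1,3}X_{1,2}$ in $K^{\widehat\otimes3}$; here $K=H^{\otimes n}$, with positions $1,\dots,n$ of $H^{\widehat\otimes2n}$ forming the first factor $K$ and $n+1,\dots,2n$ the second. A matrix $\boldsymbol a$ is transitive if $a_{i,k}\in\{a_{i,j},a_{j,k}\}$ for all $1\le i,j,k\le n$.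
   Formalization: The completions are also assumed to preserve the relation τΔ(h)=RΔ(h)R^{-1} applied in one tensor factor; this is automatic for H^{⊗m} and for topological completions by continuity, and without it the claim can fail for a non-dense completion already at n=1. *)

theory Defs
  imports "HOL-Algebra.Module" "HOL-Algebra.QuotRing"
begin

section \<open>Unital associative algebras over a field of characteristic zero\<close>

text \<open>The library locale \<^locale>\<open>algebra\<close> is restricted to commutative algebras.\<close>

locale assoc_algebra = field K + module K M + ring M
  for K :: "('k, 'r) ring_scheme" and M :: "('k, 'b, 's) module_scheme" +
  assumes char_zero: "\<And>n::nat. 0 < n \<Longrightarrow> add_pow K n \<one>\<^bsub>K\<^esub> \<noteq> \<zero>\<^bsub>K\<^esub>"
    and smult_mult_left: "\<lbrakk>c \<in> carrier K; x \<in> carrier M; y \<in> carrier M\<rbrakk>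
      \<Longrightarrow> (c \<odot>\<^bsub>M\<^esub> x) \<otimes>\<^bsub>M\<^esub> y = c \<odot>\<^bsub>M\<^esub> (x \<otimes>\<^bsub>M\<^esub> y)"
    and smult_mult_right: "\<lbrakk>c \<in> carrier K; x \<in> carrier M; y \<in> carrier M\<rbrakk>
      \<Longrightarrow> x \<otimes>\<^bsub>M\<^esub> (c \<odot>\<^bsub>M\<^esub> y) = c \<odot>\<^bsub>M\<^esub> (x \<otimes>\<^bsub>M\<^esub> y)"

definition alg_hom ::
    "('k, 'r) ring_scheme \<Rightarrow> ('k, 'a, 's) module_scheme \<Rightarrow> ('k, 'b, 't) module_scheme
      \<Rightarrow> ('a \<Rightarrow> 'b) set" where
  "alg_hom K A B = {f \<in> ring_hom A B.
     \<forall>c\<in>carrier K. \<forall>x\<in>carrier A. f (c \<odot>\<^bsub>A\<^esub> x) = c \<odot>\<^bsub>B\<^esub> f x}"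


section \<open>Algebraic tensor powers\<close>

text \<open>
  The algebra $H^{\otimes m}$ is the free $K$-module on the set $H^m$ of $m$-tuples (lists of
  length $m$), modulo the relations of multilinearity. The free module is the monoid algebra of
  the monoid $H^m$ under componentwise multiplication, and the span of the relations is an ideal
  of it, so the quotient is an algebra with the componentwise product. For $m = 0$ there is a
  single tuple and no relation, so $H^{\otimes 0}$ is $K$.
\<close>

definition tuples :: "('k, 'h, 's) module_scheme \<Rightarrow> nat \<Rightarrow> 'h list set" where
  "tuples H m = {xs. length xs = m \<and> set xs \<subseteq> carrier H}"

definition single :: "('k, 'r) ring_scheme \<Rightarrow> 'h list \<Rightarrow> 'h list \<Rightarrow> 'k" where
  "single K xs = (\<lambda>ys. if ys = xs then \<one>\<^bsub>K\<^esub> else \<zero>\<^bsub>K\<^esub>)"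

definition supp :: "('k, 'r) ring_scheme \<Rightarrow> ('h list \<Rightarrow> 'k) \<Rightarrow> 'h list set" where
  "supp K c = {xs. c xs \<noteq> \<zero>\<^bsub>K\<^esub>}"

definition tuple_algebra ::
    "('k, 'r) ring_scheme \<Rightarrow> ('k, 'h, 's) module_scheme \<Rightarrow> nat
      \<Rightarrow> ('k, 'h list \<Rightarrow> 'k) module" where
  "tuple_algebra K H m =
    \<lparr>carrier = {c. range c \<subseteq> carrier K \<and> finite (supp K c) \<and> supp K c \<subseteq> tuples H m},
     mult = (\<lambda>c d zs. finsum K (\<lambda>xs. finsum K (\<lambda>ys.
        if map2 (mult H) xs ys = zs then c xs \<otimes>\<^bsub>K\<^esub> d ys else \<zero>\<^bsub>K\<^esub>) (supp K d)) (supp K c)),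
     one = single K (replicate m \<one>\<^bsub>H\<^esub>),
     zero = (\<lambda>_. \<zero>\<^bsub>K\<^esub>),
     add = (\<lambda>c d zs. c zs \<oplus>\<^bsub>K\<^esub> d zs),
     smult = (\<lambda>k c zs. k \<otimes>\<^bsub>K\<^esub> c zs)\<rparr>"

definition multilinearity_relations ::
    "('k, 'r) ring_scheme \<Rightarrow> ('k, 'h, 's) module_scheme \<Rightarrow> nat \<Rightarrow> ('h list \<Rightarrow> 'k) set" where
  "multilinearity_relations K H m =
    (let F = tuple_algebra K H m in
     {single K (xs[i := x \<oplus>\<^bsub>H\<^esub> y]) \<ominus>\<^bsub>F\<^esub> (single K (xs[i := x]) \<oplus>\<^bsub>F\<^esub> single K (xs[i := y])) |xs i x y.
        xs \<in> tuples H m \<and> i < m \<and> x \<in> carrier H \<and> y \<in> carrier H} \<union>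
     {single K (xs[i := k \<odot>\<^bsub>H\<^esub> x]) \<ominus>\<^bsub>F\<^esub> (k \<odot>\<^bsub>F\<^esub> single K (xs[i := x])) |xs i k x.
        xs \<in> tuples H m \<and> i < m \<and> k \<in> carrier K \<and> x \<in> carrier H})"

definition tensor_ideal ::
    "('k, 'r) ring_scheme \<Rightarrow> ('k, 'h, 's) module_scheme \<Rightarrow> nat \<Rightarrow> ('h list \<Rightarrow> 'k) set" where
  "tensor_ideal K H m = genideal (tuple_algebra K H m) (multilinearity_relations K H m)"

definition tensor_class ::
    "('k, 'r) ring_scheme \<Rightarrow> ('k, 'h, 's) module_scheme \<Rightarrow> nat \<Rightarrow> ('h list \<Rightarrow> 'k)
      \<Rightarrow> ('h list \<Rightarrow> 'k) set" where
  "tensor_class K H m c = a_r_coset (tuple_algebra K H m) (tensor_ideal K H m) c"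

text \<open>As in \<^const>\<open>FactRing\<close>, an operation on cosets is the union of the cosets obtained from all
  representatives; these all coincide.\<close>

definition tensor_power ::
    "('k, 'r) ring_scheme \<Rightarrow> ('k, 'h, 's) module_scheme \<Rightarrow> nat
      \<Rightarrow> ('k, ('h list \<Rightarrow> 'k) set) module" where
  "tensor_power K H m =
    ring.extend (tuple_algebra K H m Quot tensor_ideal K H m)
      (module.fields (\<lambda>k X. \<Union>c\<in>X. tensor_class K H m (k \<odot>\<^bsub>tuple_algebra K H m\<^esub> c)))"

definition pure ::
    "('k, 'r) ring_scheme \<Rightarrow> ('k, 'h, 's) module_scheme \<Rightarrow> 'h list \<Rightarrow> ('h list \<Rightarrow> 'k) set" where
  "pure K H xs = tensor_class K H (length xs) (single K xs)"

text \<open>The canonical bilinear map from $H^{\otimes p}$ and $H^{\otimes q}$ to $H^{\otimes (p+q)}$.\<close>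

definition tensor_append ::
    "('k, 'r) ring_scheme \<Rightarrow> ('k, 'h, 's) module_scheme \<Rightarrow> nat \<Rightarrow> nat
      \<Rightarrow> ('h list \<Rightarrow> 'k) set \<Rightarrow> ('h list \<Rightarrow> 'k) set \<Rightarrow> ('h list \<Rightarrow> 'k) set" where
  "tensor_append K H p q X Y =
    (\<Union>c\<in>X. \<Union>d\<in>Y. tensor_class K H (p + q) (\<lambda>zs. c (take p zs) \<otimes>\<^bsub>K\<^esub> d (drop p zs)))"


section \<open>Bialgebras\<close>

text \<open>
  Coassociativity and the counit axioms are written for an arbitrary presentation of
  $\Delta(h)$ as a finite sum of pure tensors $a_k \otimes b_k$.
\<close>

locale bialgebra = assoc_algebra K H
  for K :: "('k, 'r) ring_scheme" and H :: "('k, 'h, 's) module_scheme" +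
  fixes \<Delta> :: "'h \<Rightarrow> ('h list \<Rightarrow> 'k) set"
    and \<epsilon> :: "'h \<Rightarrow> 'k"
  assumes comult_hom: "\<Delta> \<in> alg_hom K H (tensor_power K H 2)"
    and counit_hom: "\<epsilon> \<in> ring_hom H K"
    and counit_smult: "\<lbrakk>c \<in> carrier K; h \<in> carrier H\<rbrakk> \<Longrightarrow> \<epsilon> (c \<odot>\<^bsub>H\<^esub> h) = c \<otimes>\<^bsub>K\<^esub> \<epsilon> h"
    and coassociative:
      "\<And>h (N::nat) a b. \<lbrakk>h \<in> carrier H; a \<in> {..<N} \<rightarrow> carrier H; b \<in> {..<N} \<rightarrow> carrier H;
         \<Delta> h = finsum (tensor_power K H 2) (\<lambda>k. pure K H [a k, b k]) {..<N}\<rbrakk> \<Longrightarrow>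
       finsum (tensor_power K H 3) (\<lambda>k. tensor_append K H 2 1 (\<Delta> (a k)) (pure K H [b k])) {..<N} =
       finsum (tensor_power K H 3) (\<lambda>k. tensor_append K H 1 2 (pure K H [a k]) (\<Delta> (b k))) {..<N}"
    and counital:
      "\<And>h (N::nat) a b. \<lbrakk>h \<in> carrier H; a \<in> {..<N} \<rightarrow> carrier H; b \<in> {..<N} \<rightarrow> carrier H;
         \<Delta> h = finsum (tensor_power K H 2) (\<lambda>k. pure K H [a k, b k]) {..<N}\<rbrakk> \<Longrightarrow>
       finsum H (\<lambda>k. \<epsilon> (a k) \<odot>\<^bsub>H\<^esub> b k) {..<N} = h \<and>
       finsum H (\<lambda>k. \<epsilon> (b k) \<odot>\<^bsub>H\<^esub> a k) {..<N} = h"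


section \<open>Completed tensor powers\<close>

text \<open>
  Positions are numbered from 1. A list \<open>\<sigma>\<close> of distinct elements of \<open>{1..p}\<close> encodes the
  embedding of legs sending the factor in position \<open>k\<close> to position \<open>\<sigma> ! (k - 1)\<close> of $p$ factors,
  with 1 in the positions outside \<open>\<sigma>\<close>; for \<open>length \<sigma> = p\<close> it is a permutation of the factors.
\<close>

definition is_leg :: "nat \<Rightarrow> nat list \<Rightarrow> bool" where
  "is_leg p \<sigma> \<longleftrightarrow> distinct \<sigma> \<and> set \<sigma> \<subseteq> {1..p}"

definition place :: "('k, 'h, 's) module_scheme \<Rightarrow> nat \<Rightarrow> nat list \<Rightarrow> 'h list \<Rightarrow> 'h list" where
  "place H p \<sigma> xs =
    map (\<lambda>j. case map_of (zip \<sigma> xs) j of None \<Rightarrow> \<one>\<^bsub>H\<^esub> | Some h \<Rightarrow> h) [1..<p + 1]"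

text \<open>
  \<open>A m\<close> is the completion of $H^{\otimes m}$, with inclusion \<open>inc m\<close>; \<open>leg p \<sigma>\<close> is the extended
  embedding of legs, and \<open>cop m i\<close>, \<open>cou m i\<close> are the extensions of $\Delta$ and $\epsilon$ applied
  to the \<open>i\<close>-th of \<open>m\<close> factors. The choice of \<open>A m\<close> as $H^{\otimes m}$ itself is allowed.

  The last assumption says that an identity $\tau\Delta(h) = U\Delta(h)U^{-1}$ of algebra
  homomorphisms on $H$, applied in one factor, is preserved in the completions. It is automatic
  for $H^{\otimes m}$ itself, and for topological completions by continuity. It does not follow
  from the other assumptions, since nothing there forces $H^{\otimes m}$ to be dense in \<open>A m\<close>.
\<close>

locale completed_tensor_powers = bialgebra K H \<Delta> \<epsilon>
  for K :: "('k, 'r) ring_scheme" and H :: "('k, 'h, 's) module_scheme"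
    and \<Delta> :: "'h \<Rightarrow> ('h list \<Rightarrow> 'k) set" and \<epsilon> :: "'h \<Rightarrow> 'k" +
  fixes A :: "nat \<Rightarrow> ('k, 'a, 't) module_scheme"
    and inc :: "nat \<Rightarrow> ('h list \<Rightarrow> 'k) set \<Rightarrow> 'a"
    and leg :: "nat \<Rightarrow> nat list \<Rightarrow> 'a \<Rightarrow> 'a"
    and cop :: "nat \<Rightarrow> nat \<Rightarrow> 'a \<Rightarrow> 'a"
    and cou :: "nat \<Rightarrow> nat \<Rightarrow> 'a \<Rightarrow> 'a"
  assumes completion_algebra: "assoc_algebra K (A m)"
    and inc_hom: "inc m \<in> alg_hom K (tensor_power K H m) (A m)"
    and inc_inj: "inj_on (inc m) (carrier (tensor_power K H m))"
    and leg_hom: "is_leg p \<sigma> \<Longrightarrow> leg p \<sigma> \<in> alg_hom K (A (length \<sigma>)) (A p)"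
    and leg_extends: "\<lbrakk>is_leg p \<sigma>; xs \<in> tuples H (length \<sigma>)\<rbrakk> \<Longrightarrow>
      leg p \<sigma> (inc (length \<sigma>) (pure K H xs)) = inc p (pure K H (place H p \<sigma> xs))"
    and cop_hom: "i \<in> {1..m} \<Longrightarrow> cop m i \<in> alg_hom K (A m) (A (m + 1))"
    and cop_extends: "\<lbrakk>i \<in> {1..m}; xs \<in> tuples H m\<rbrakk> \<Longrightarrow>
      cop m i (inc m (pure K H xs)) = inc (m + 1)
        (tensor_append K H (i + 1) (m - i)
          (tensor_append K H (i - 1) 2 (pure K H (take (i - 1) xs)) (\<Delta> (xs ! (i - 1))))
          (pure K H (drop i xs)))"
    and cou_hom: "i \<in> {1..m} \<Longrightarrow> cou m i \<in> alg_hom K (A m) (A (m - 1))"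
    and cou_extends: "\<lbrakk>i \<in> {1..m}; xs \<in> tuples H m\<rbrakk> \<Longrightarrow>
      cou m i (inc m (pure K H xs)) =
        \<epsilon> (xs ! (i - 1)) \<odot>\<^bsub>A (m - 1)\<^esub> inc (m - 1) (pure K H (take (i - 1) xs @ drop i xs))"
    and leg_id: "x \<in> carrier (A m) \<Longrightarrow> leg m [1..<m + 1] x = x"
    and leg_comp: "\<lbrakk>is_leg p \<sigma>; is_leg q \<rho>; length \<rho> = p; x \<in> carrier (A (length \<sigma>))\<rbrakk> \<Longrightarrow>
      leg q \<rho> (leg p \<sigma> x) = leg q (map (\<lambda>k. \<rho> ! (k - 1)) \<sigma>) x"
    and leg_commute: "\<lbrakk>is_leg p \<sigma>; is_leg p \<rho>; set \<sigma> \<inter> set \<rho> = {};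
        x \<in> carrier (A (length \<sigma>)); y \<in> carrier (A (length \<rho>))\<rbrakk> \<Longrightarrow>
      leg p \<sigma> x \<otimes>\<^bsub>A p\<^esub> leg p \<rho> y = leg p \<rho> y \<otimes>\<^bsub>A p\<^esub> leg p \<sigma> x"
    and cop_coassoc: "\<lbrakk>i \<in> {1..m}; x \<in> carrier (A m)\<rbrakk> \<Longrightarrow>
      cop (m + 1) i (cop m i x) = cop (m + 1) (i + 1) (cop m i x)"
    and cop_counit: "\<lbrakk>i \<in> {1..m}; x \<in> carrier (A m)\<rbrakk> \<Longrightarrow>
      cou (m + 1) i (cop m i x) = x \<and> cou (m + 1) (i + 1) (cop m i x) = x"
    and flip_conjugation: "\<lbrakk>U \<in> Units (A 2);
        \<forall>h\<in>carrier H. leg 2 [2, 1] (inc 2 (\<Delta> h)) = U \<otimes>\<^bsub>A 2\<^esub> inc 2 (\<Delta> h) \<otimes>\<^bsub>A 2\<^esub> inv\<^bsub>A 2\<^esub> U;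
        i \<in> {1..m}; x \<in> carrier (A m)\<rbrakk> \<Longrightarrow>
      leg (m + 1) ([1..<i] @ [i + 1, i] @ [i + 2..<m + 2]) (cop m i x) =
        leg (m + 1) [i, i + 1] U \<otimes>\<^bsub>A (m + 1)\<^esub> cop m i x
          \<otimes>\<^bsub>A (m + 1)\<^esub> inv\<^bsub>A (m + 1)\<^esub> (leg (m + 1) [i, i + 1] U)"


section \<open>R-matrices and the quantum Yang-Baxter equation\<close>

definition (in completed_tensor_powers) R_matrix :: "'a \<Rightarrow> bool" where
  "R_matrix R \<longleftrightarrow>
     R \<in> Units (A 2) \<and>
     (\<forall>h\<in>carrier H. leg 2 [2, 1] (inc 2 (\<Delta> h)) = R \<otimes>\<^bsub>A 2\<^esub> inc 2 (\<Delta> h) \<otimes>\<^bsub>A 2\<^esub> inv\<^bsub>A 2\<^esub> R) \<and>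
     cop 2 1 R = leg 3 [1, 3] R \<otimes>\<^bsub>A 3\<^esub> leg 3 [2, 3] R \<and>
     cop 2 2 R = leg 3 [1, 3] R \<otimes>\<^bsub>A 3\<^esub> leg 3 [1, 2] R"

definition (in completed_tensor_powers) signed_R :: "'a \<Rightarrow> int \<Rightarrow> 'a" where
  "signed_R R s = (if s = 1 then R else inv\<^bsub>A 2\<^esub> (leg 2 [2, 1] R))"

text \<open>The product of a list in the given order, from left to right.\<close>

definition ordered_prod :: "('a, 's) monoid_scheme \<Rightarrow> 'a list \<Rightarrow> 'a" where
  "ordered_prod G xs = foldr (mult G) xs \<one>\<^bsub>G\<^esub>"

definition (in completed_tensor_powers) bold_R :: "nat \<Rightarrow> (nat \<Rightarrow> nat \<Rightarrow> int) \<Rightarrow> 'a \<Rightarrow> 'a" where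
  "bold_R n a R =
     ordered_prod (A (2 * n)) (map (\<lambda>j.
       ordered_prod (A (2 * n)) (map (\<lambda>i.
         leg (2 * n) [i, n + j] (signed_R R (a j i))) [1..<n + 1])) (rev [1..<n + 1]))"

text \<open>The quantum Yang-Baxter equation over $H^{\otimes n}$, for an element of the completion of
  $H^{\otimes 2n}$: each factor $H^{\otimes n}$ is a block of \<open>n\<close> consecutive positions.\<close>

definition block :: "nat \<Rightarrow> nat \<Rightarrow> nat list" where
  "block n b = [(b - 1) * n + 1..<b * n + 1]"

definition (in completed_tensor_powers) solves_QYBE :: "nat \<Rightarrow> 'a \<Rightarrow> bool" where
  "solves_QYBE n X \<longleftrightarrow>
    (let X_leg = (\<lambda>b c. leg (3 * n) (block n b @ block n c) X) in
      X \<in> carrier (A (2 * n)) \<and>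
      X_leg 1 2 \<otimes>\<^bsub>A (3 * n)\<^esub> X_leg 1 3 \<otimes>\<^bsub>A (3 * n)\<^esub> X_leg 2 3 =
      X_leg 2 3 \<otimes>\<^bsub>A (3 * n)\<^esub> X_leg 1 3 \<otimes>\<^bsub>A (3 * n)\<^esub> X_leg 1 2)"

definition transitive_matrix :: "nat \<Rightarrow> (nat \<Rightarrow> nat \<Rightarrow> int) \<Rightarrow> bool" where
  "transitive_matrix n a \<longleftrightarrow>
    (\<forall>i\<in>{1..n}. \<forall>j\<in>{1..n}. \<forall>k\<in>{1..n}. a i k \<in> {a i j, a j k})"

end

theory Submission
  imports Defs
begin

text \<open>
  Applying $\Delta$ to the first factor of $R$ and conjugating by $R$ gives the Yang-Baxter equation
  for $R$. Moving inverses across it, $X_{i,j}X_{i,k}X_{j,k} = X_{j,k}X_{i,k}X_{i,j}$ holds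
  for $X_{i,j} = R_{i,j}^{(s)}$, $X_{i,k} = R_{i,k}^{(t)}$, $X_{j,k} = R_{j,k}^{(u)}$ whenever
  $t \in \{s, u\}$, and transitivity of the sign matrix provides exactly this for the legs of
  the three blocks. As factors in disjoint legs commute, these equations
  fuse one block at a time: the products over the first and the third block run through their
  index in the same order on both sides, those over the second block in opposite orders.
\<close>

section \<open>Ordered products and fusion in monoids\<close>

lemma ordered_prod_Nil [simp]: "ordered_prod G [] = \<one>\<^bsub>G\<^esub>"
  by (simp add: ordered_prod_def)

lemma ordered_prod_Cons [simp]: "ordered_prod G (x # xs) = x \<otimes>\<^bsub>G\<^esub> ordered_prod G xs"
  by (simp add: ordered_prod_def)

lemma ring_hom_ordered_prod:
  assumes "h \<in> ring_hom A B" "ring A" "set xs \<subseteq> carrier A"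
  shows "h (ordered_prod A xs) = ordered_prod B (map h xs)"
proof -
  interpret A: ring A by fact
  have closed: "ordered_prod A ys \<in> carrier A" if "set ys \<subseteq> carrier A" for ys
    using that by (induction ys) auto
  show ?thesis
    using assms(3) by (induction xs) (auto simp: ring_hom_one[OF assms(1)] ring_hom_mult[OF assms(1)] closed)
qed

lemma ring_hom_Units:
  assumes h: "h \<in> ring_hom A B" and "ring A" "ring B" and u: "u \<in> Units A"
  shows "h u \<in> Units B" and "h (inv\<^bsub>A\<^esub> u) = inv\<^bsub>B\<^esub> (h u)"
proof -
  interpret A: ring A by fact
  interpret B: ring B by fact
  note A.Units_closed[OF u, simp]
  have carr: "h u \<in> carrier B" "h (inv\<^bsub>A\<^esub> u) \<in> carrier B"
    using ring_hom_closed[OF h] u by auto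
  have r: "h u \<otimes>\<^bsub>B\<^esub> h (inv\<^bsub>A\<^esub> u) = \<one>\<^bsub>B\<^esub>"
    using ring_hom_mult[OF h, of u "inv\<^bsub>A\<^esub> u"] u ring_hom_one[OF h] by simp
  have l: "h (inv\<^bsub>A\<^esub> u) \<otimes>\<^bsub>B\<^esub> h u = \<one>\<^bsub>B\<^esub>"
    using ring_hom_mult[OF h, of "inv\<^bsub>A\<^esub> u" u] u ring_hom_one[OF h] by simp
  show "h u \<in> Units B"
    unfolding Units_def using carr l r by blast
  show "h (inv\<^bsub>A\<^esub> u) = inv\<^bsub>B\<^esub> (h u)"
    using B.inv_char[OF carr r l] by simp
qed

context monoid
begin

lemma ordered_prod_closed [simp]: "set xs \<subseteq> carrier G \<Longrightarrow> ordered_prod G xs \<in> carrier G"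
  by (induction xs) auto

lemma ordered_prod_append:
  "set xs \<subseteq> carrier G \<Longrightarrow> set ys \<subseteq> carrier G \<Longrightarrow>
    ordered_prod G (xs @ ys) = ordered_prod G xs \<otimes> ordered_prod G ys"
  by (induction xs) (auto simp: m_assoc)

lemma commute_ordered_prod:
  assumes "z \<in> carrier G" "set xs \<subseteq> carrier G" "\<And>x. x \<in> set xs \<Longrightarrow> z \<otimes> x = x \<otimes> z"
  shows "z \<otimes> ordered_prod G xs = ordered_prod G xs \<otimes> z"
  using assms(2,3)
proof (induction xs)
  case (Cons x xs)
  let ?p = "ordered_prod G xs"
  have c: "x \<in> carrier G" "?p \<in> carrier G" using Cons.prems by auto
  have "z \<otimes> (x \<otimes> ?p) = x \<otimes> (z \<otimes> ?p)"
    using c assms(1) Cons.prems(2)[of x] by (simp flip: m_assoc)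
  also have "\<dots> = x \<otimes> ?p \<otimes> z" using Cons c assms(1) by (simp add: m_assoc)
  finally show ?case by simp
qed (use assms in simp)

lemma ordered_prods_commute:
  assumes "set xs \<subseteq> carrier G" "set ys \<subseteq> carrier G"
    and "\<And>x y. x \<in> set xs \<Longrightarrow> y \<in> set ys \<Longrightarrow> x \<otimes> y = y \<otimes> x"
  shows "ordered_prod G xs \<otimes> ordered_prod G ys = ordered_prod G ys \<otimes> ordered_prod G xs"
proof (rule commute_ordered_prod)
  fix y assume y: "y \<in> set ys"
  show "ordered_prod G xs \<otimes> y = y \<otimes> ordered_prod G xs"
    using commute_ordered_prod[of y xs] assms y by force
qed (use assms in auto)

section \<open>Fusion of braid equations\<close>

text \<open>\<open>x'\<close> slides past \<open>y\<close>, which brings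
  \<open>x' \<otimes> y' \<otimes> z\<close> together; \<open>z\<close> then travels left through
  both triples, and \<open>x\<close> slides past \<open>y'\<close>. The two fused products keep the
  same order because each pair moves to the other side of \<open>z\<close> as a whole.\<close>

lemma braid_mult_outer:
  assumes c: "x \<in> carrier G" "x' \<in> carrier G" "y \<in> carrier G" "y' \<in> carrier G" "z \<in> carrier G"
    and 1: "x \<otimes> y \<otimes> z = z \<otimes> y \<otimes> x" and 2: "x' \<otimes> y' \<otimes> z = z \<otimes> y' \<otimes> x'"
    and 3: "x' \<otimes> y = y \<otimes> x'" and 4: "x \<otimes> y' = y' \<otimes> x"
  shows "(x \<otimes> x') \<otimes> (y \<otimes> y') \<otimes> z = z \<otimes> (y \<otimes> y') \<otimes> (x \<otimes> x')"
proof -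
  have "(x \<otimes> x') \<otimes> (y \<otimes> y') \<otimes> z = x \<otimes> (x' \<otimes> y) \<otimes> y' \<otimes> z" using c by (simp add: m_assoc)
  also have "\<dots> = x \<otimes> y \<otimes> (x' \<otimes> y' \<otimes> z)" unfolding 3 using c by (simp add: m_assoc)
  also have "\<dots> = (x \<otimes> y \<otimes> z) \<otimes> y' \<otimes> x'" unfolding 2 using c by (simp add: m_assoc)
  also have "\<dots> = z \<otimes> y \<otimes> (x \<otimes> y') \<otimes> x'" unfolding 1 using c by (simp add: m_assoc)
  also have "\<dots> = z \<otimes> (y \<otimes> y') \<otimes> (x \<otimes> x')" unfolding 4 using c by (simp add: m_assoc)
  finally show ?thesis .
qed

text \<open>The opposite orders \<open>x' \<otimes> x\<close> and \<open>z \<otimes> z'\<close> nest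
  the triple \<open>x\<close>, \<open>y\<close>, \<open>z\<close> inside \<open>x'\<close>,
  \<open>y\<close>, \<open>z'\<close>. Once the inner triple is reversed, the two commutations move
  \<open>x\<close> and \<open>z\<close> outwards and leave the outer triple adjacent.\<close>

lemma braid_mult_middle:
  assumes c: "x \<in> carrier G" "x' \<in> carrier G" "y \<in> carrier G" "z \<in> carrier G" "z' \<in> carrier G"
    and 1: "x \<otimes> y \<otimes> z = z \<otimes> y \<otimes> x" and 2: "x' \<otimes> y \<otimes> z' = z' \<otimes> y \<otimes> x'"
    and 3: "x' \<otimes> z = z \<otimes> x'" and 4: "x \<otimes> z' = z' \<otimes> x"
  shows "(x' \<otimes> x) \<otimes> y \<otimes> (z \<otimes> z') = (z \<otimes> z') \<otimes> y \<otimes> (x' \<otimes> x)"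
proof -
  have "(x' \<otimes> x) \<otimes> y \<otimes> (z \<otimes> z') = x' \<otimes> (x \<otimes> y \<otimes> z) \<otimes> z'" using c by (simp add: m_assoc)
  also have "\<dots> = (x' \<otimes> z) \<otimes> y \<otimes> (x \<otimes> z')" unfolding 1 using c by (simp add: m_assoc)
  also have "\<dots> = z \<otimes> (x' \<otimes> y \<otimes> z') \<otimes> x" unfolding 3 4 using c by (simp add: m_assoc)
  also have "\<dots> = (z \<otimes> z') \<otimes> y \<otimes> (x' \<otimes> x)" unfolding 2 using c by (simp add: m_assoc)
  finally show ?thesis .
qed

text \<open>Fusion over an index shared by two families, by induction: the head is \<open>x\<close>,
  \<open>y\<close> and the products over the tail are \<open>x'\<close>, \<open>y'\<close> in
  \<open>braid_mult_outer\<close>. Distinctness makes the head index differ from every tail index,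
  so the cross terms commute.\<close>

lemma braid_ordered_prod_outer:
  assumes z: "z \<in> carrier G" and "distinct is"
    and "\<And>i. i \<in> set is \<Longrightarrow> x i \<in> carrier G" "\<And>i. i \<in> set is \<Longrightarrow> y i \<in> carrier G"
    and "\<And>i. i \<in> set is \<Longrightarrow> x i \<otimes> y i \<otimes> z = z \<otimes> y i \<otimes> x i"
    and "\<And>i j. i \<in> set is \<Longrightarrow> j \<in> set is \<Longrightarrow> i \<noteq> j \<Longrightarrow> x i \<otimes> y j = y j \<otimes> x i"
  shows "ordered_prod G (map x is) \<otimes> ordered_prod G (map y is) \<otimes> z =
    z \<otimes> ordered_prod G (map y is) \<otimes> ordered_prod G (map x is)"
  using assms(2-)
proof (induction "is")
  case (Cons i "is")
  note c = Cons.prems(2,3)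
  have closed: "set (map x is) \<subseteq> carrier G" "set (map y is) \<subseteq> carrier G"
    using c by auto
  have "y i \<otimes> ordered_prod G (map x is) = ordered_prod G (map x is) \<otimes> y i"
    by (rule commute_ordered_prod) (use closed Cons.prems(1-3) in \<open>auto intro!: Cons.prems(5)[symmetric]\<close>)
  moreover have "x i \<otimes> ordered_prod G (map y is) = ordered_prod G (map y is) \<otimes> x i"
    by (rule commute_ordered_prod) (use closed Cons.prems(1-3) in \<open>auto intro!: Cons.prems(5)\<close>)
  moreover have "ordered_prod G (map x is) \<otimes> ordered_prod G (map y is) \<otimes> z =
      z \<otimes> ordered_prod G (map y is) \<otimes> ordered_prod G (map x is)"
    using Cons by simp
  ultimately show ?case
    unfolding list.map ordered_prod_Cons
    by (intro braid_mult_outer) (use z closed Cons.prems in auto)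
qed (use z in simp)

text \<open>Fusion over the index shared by the two outer factors. Only one of the two products is
  reversed, as the nesting in \<open>braid_mult_middle\<close> demands.\<close>

lemma braid_ordered_prod_middle:
  assumes y: "y \<in> carrier G" and "distinct js"
    and "\<And>j. j \<in> set js \<Longrightarrow> x j \<in> carrier G" "\<And>j. j \<in> set js \<Longrightarrow> z j \<in> carrier G"
    and "\<And>j. j \<in> set js \<Longrightarrow> x j \<otimes> y \<otimes> z j = z j \<otimes> y \<otimes> x j"
    and "\<And>j k. j \<in> set js \<Longrightarrow> k \<in> set js \<Longrightarrow> j \<noteq> k \<Longrightarrow> x j \<otimes> z k = z k \<otimes> x j"
  shows "ordered_prod G (map x (rev js)) \<otimes> y \<otimes> ordered_prod G (map z js) =
    ordered_prod G (map z js) \<otimes> y \<otimes> ordered_prod G (map x (rev js))"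
  using assms(2-)
proof (induction js)
  case (Cons j js)
  note c = Cons.prems(2,3)
  have closed: "set (map x (rev js)) \<subseteq> carrier G" "set (map z js) \<subseteq> carrier G"
    using c by auto
  \<comment> \<open>Reversal puts the head at the right end, next to \<open>y\<close>, so the head
    gives the inner triple and the tail the outer one.\<close>
  have snoc: "ordered_prod G (map x (rev (j # js))) = ordered_prod G (map x (rev js)) \<otimes> x j"
    using closed c by (simp add: ordered_prod_append)
  have "z j \<otimes> ordered_prod G (map x (rev js)) = ordered_prod G (map x (rev js)) \<otimes> z j"
    by (rule commute_ordered_prod) (use closed Cons.prems(1-3) in \<open>auto intro!: Cons.prems(5)[symmetric]\<close>)
  moreover have "x j \<otimes> ordered_prod G (map z js) = ordered_prod G (map z js) \<otimes> x j"
    by (rule commute_ordered_prod) (use closed Cons.prems(1-3) in \<open>auto intro!: Cons.prems(5)\<close>)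
  moreover have "ordered_prod G (map x (rev js)) \<otimes> y \<otimes> ordered_prod G (map z js) =
      ordered_prod G (map z js) \<otimes> y \<otimes> ordered_prod G (map x (rev js))"
    using Cons by simp
  ultimately show ?case
    unfolding snoc unfolding list.map ordered_prod_Cons
    by (intro braid_mult_middle) (use y closed Cons.prems in auto)
qed (use y in simp)

text \<open>The indices are fused one after another: \<open>i\<close> with \<open>z j k\<close>
  fixed, \<open>j\<close> around the already fused middle factor, and finally \<open>k\<close> with
  the complete \<open>X\<close> fixed. At each stage, factors with different values of the index
  being fused commute.\<close>

theorem block_braid_equation:
  assumes d: "distinct is" "distinct js" "distinct ks"
    and x: "\<And>i j. i \<in> set is \<Longrightarrow> j \<in> set js \<Longrightarrow> x i j \<in> carrier G"
    and y: "\<And>i k. i \<in> set is \<Longrightarrow> k \<in> set ks \<Longrightarrow> y i k \<in> carrier G"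
    and z: "\<And>j k. j \<in> set js \<Longrightarrow> k \<in> set ks \<Longrightarrow> z j k \<in> carrier G"
    and braid: "\<And>i j k. i \<in> set is \<Longrightarrow> j \<in> set js \<Longrightarrow> k \<in> set ks \<Longrightarrow>
      x i j \<otimes> y i k \<otimes> z j k = z j k \<otimes> y i k \<otimes> x i j"
    and xy: "\<And>i i' j k. i \<in> set is \<Longrightarrow> i' \<in> set is \<Longrightarrow> j \<in> set js \<Longrightarrow> k \<in> set ks \<Longrightarrow> i \<noteq> i' \<Longrightarrow>
      x i j \<otimes> y i' k = y i' k \<otimes> x i j"
    and xz: "\<And>i j j' k. i \<in> set is \<Longrightarrow> j \<in> set js \<Longrightarrow> j' \<in> set js \<Longrightarrow> k \<in> set ks \<Longrightarrow> j \<noteq> j' \<Longrightarrow>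
      x i j \<otimes> z j' k = z j' k \<otimes> x i j"
    and yz: "\<And>i j k k'. i \<in> set is \<Longrightarrow> j \<in> set js \<Longrightarrow> k \<in> set ks \<Longrightarrow> k' \<in> set ks \<Longrightarrow> k \<noteq> k' \<Longrightarrow>
      y i k \<otimes> z j k' = z j k' \<otimes> y i k"
  defines "X \<equiv> ordered_prod G (map (\<lambda>j. ordered_prod G (map (\<lambda>i. x i j) is)) (rev js))"
    and "Y \<equiv> ordered_prod G (map (\<lambda>k. ordered_prod G (map (\<lambda>i. y i k) is)) ks)"
    and "Z \<equiv> ordered_prod G (map (\<lambda>k. ordered_prod G (map (\<lambda>j. z j k) js)) ks)"
  shows "X \<otimes> Y \<otimes> Z = Z \<otimes> Y \<otimes> X"
proof -
  define x' where "x' j = ordered_prod G (map (\<lambda>i. x i j) is)" for j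
  define y' where "y' k = ordered_prod G (map (\<lambda>i. y i k) is)" for k
  define z' where "z' k = ordered_prod G (map (\<lambda>j. z j k) js)" for k
  have x': "x' j \<in> carrier G" if "j \<in> set js" for j
    unfolding x'_def using that x by (intro ordered_prod_closed) auto
  have y': "y' k \<in> carrier G" if "k \<in> set ks" for k
    unfolding y'_def using that y by (intro ordered_prod_closed) auto
  have z': "z' k \<in> carrier G" if "k \<in> set ks" for k
    unfolding z'_def using that z by (intro ordered_prod_closed) auto
  have X_carr: "X \<in> carrier G"
    unfolding X_def x'_def[symmetric] using x' by (intro ordered_prod_closed) auto
  have 1: "x' j \<otimes> y' k \<otimes> z j k = z j k \<otimes> y' k \<otimes> x' j" if "j \<in> set js" "k \<in> set ks" for j k
    unfolding x'_def y'_def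
    by (rule braid_ordered_prod_outer) (use that d x y z braid xy in auto)
  \<comment> \<open>\<open>X\<close> runs through \<open>rev js\<close> and \<open>z' k\<close>
    through \<open>js\<close>, the pair of opposite orders that fusion in the middle
    requires.\<close>
  have 2: "X \<otimes> y' k \<otimes> z' k = z' k \<otimes> y' k \<otimes> X" if k: "k \<in> set ks" for k
    unfolding X_def x'_def[symmetric] z'_def
  proof (rule braid_ordered_prod_middle)
    fix j j' assume j: "j \<in> set js" "j' \<in> set js" "j \<noteq> j'"
    have "z j' k \<otimes> x' j = x' j \<otimes> z j' k"
      unfolding x'_def by (rule commute_ordered_prod) (use j k x z xz in auto)
    then show "x' j \<otimes> z j' k = z j' k \<otimes> x' j" by simp
  qed (use k d x' y' z 1 in auto)
  have comm: "z' k' \<otimes> y' k = y' k \<otimes> z' k'" if "k \<in> set ks" "k' \<in> set ks" "k \<noteq> k'" for k k'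
    unfolding y'_def z'_def
    by (rule ordered_prods_commute) (use that y z in \<open>auto simp: yz\<close>)
  \<comment> \<open>The braid equation is symmetric under reversal: \<open>2\<close> read from right
    to left has \<open>z'\<close>, \<open>y'\<close> as the families to be fused and
    \<open>X\<close> as the fixed factor.\<close>
  have "ordered_prod G (map z' ks) \<otimes> ordered_prod G (map y' ks) \<otimes> X =
      X \<otimes> ordered_prod G (map y' ks) \<otimes> ordered_prod G (map z' ks)"
    by (rule braid_ordered_prod_outer) (use X_carr d y' z' 2 comm in auto)
  then show ?thesis
    unfolding Y_def Z_def y'_def z'_def by simp
qed

section \<open>Inverses in braid equations with signs\<close>

text \<open>Serves the sign patterns with one inverted factor: \<open>g\<close> stands at opposite
  ends of the two sides of a braid equation, and multiplying by \<open>inv g\<close> on the left and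
  on the right exchanges the ends.\<close>

lemma Units_inv_shift:
  assumes "g \<in> Units G" "x \<in> carrier G" "y \<in> carrier G" "x \<otimes> g = g \<otimes> y"
  shows "inv g \<otimes> x = y \<otimes> inv g"
proof -
  have "inv g \<otimes> x = inv g \<otimes> x \<otimes> (g \<otimes> inv g)" using assms(1-3) by simp
  also have "\<dots> = inv g \<otimes> (x \<otimes> g) \<otimes> inv g"
    using assms(1-3) by (simp add: m_assoc Units_closed del: Units_r_inv)
  also have "\<dots> = y \<otimes> inv g" unfolding assms(4) using assms(1-3) by (simp add: Units_closed flip: m_assoc)
  finally show ?thesis .
qed

text \<open>Serves the sign patterns with two inverted factors: \<open>g\<close> and
  \<open>h\<close> are the products of these two factors in the two orders, and \<open>x\<close> is
  the factor that keeps its sign.\<close>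

lemma Units_inv_intertwine:
  assumes "g \<in> Units G" "h \<in> Units G" "x \<in> carrier G" "g \<otimes> x = x \<otimes> h"
  shows "inv g \<otimes> x = x \<otimes> inv h"
proof -
  have "inv g \<otimes> x = inv g \<otimes> x \<otimes> (h \<otimes> inv h)" using assms(1-3) by simp
  also have "\<dots> = inv g \<otimes> (x \<otimes> h) \<otimes> inv h"
    using assms(1-3) by (simp add: m_assoc Units_closed del: Units_r_inv)
  also have "\<dots> = x \<otimes> inv h" unfolding assms(4)[symmetric]
    using assms(1-3) by (simp add: Units_closed flip: m_assoc)
  finally show ?thesis .
qed

lemma Units_inv_mult:
  assumes "g \<in> Units G" "h \<in> Units G"
  shows "inv (g \<otimes> h) = inv h \<otimes> inv g"
proof (rule inv_char)
  note c = assms[THEN Units_closed]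
  have "(g \<otimes> h) \<otimes> (inv h \<otimes> inv g) = g \<otimes> (h \<otimes> inv h) \<otimes> inv g"
    using assms c by (simp add: m_assoc del: Units_r_inv)
  then show "(g \<otimes> h) \<otimes> (inv h \<otimes> inv g) = \<one>" using assms c by simp
  have "(inv h \<otimes> inv g) \<otimes> (g \<otimes> h) = inv h \<otimes> (inv g \<otimes> g) \<otimes> h"
    using assms c by (simp add: m_assoc del: Units_l_inv)
  then show "(inv h \<otimes> inv g) \<otimes> (g \<otimes> h) = \<one>" using assms c by simp
qed (use assms in auto)

text \<open>
  Reading each sign as the direction of an edge between two of the vertices $i, j, k$, the
  condition $t \in \{s, u\}$ excludes exactly the two cyclic tournaments; each of the other six
  cases is the Yang-Baxter equation for the vertices listed in their linear order.
\<close>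

lemma signed_braid_equation:
  fixes e s t u :: 'c
  assumes P: "\<And>i j. {i, j} \<subseteq> I \<Longrightarrow> i \<noteq> j \<Longrightarrow> P i j \<in> Units G"
    and braid: "\<And>i j k. {i, j, k} \<subseteq> I \<Longrightarrow> distinct [i, j, k] \<Longrightarrow>
      P i j \<otimes> P i k \<otimes> P j k = P j k \<otimes> P i k \<otimes> P i j"
    and I: "{i, j, k} \<subseteq> I" "distinct [i, j, k]"
    and t: "t \<in> {s, u}"
  defines "S \<equiv> \<lambda>v i j. if v = e then P i j else inv (P j i)"
  shows "S s i j \<otimes> S t i k \<otimes> S u j k = S u j k \<otimes> S t i k \<otimes> S s i j"
proof -
  have U: "P i j \<in> Units G" "P j i \<in> Units G" "P i k \<in> Units G" "P k i \<in> Units G"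
    "P j k \<in> Units G" "P k j \<in> Units G"
    using P I by auto
  note c = U[THEN Units_closed] U[THEN Units_inv_closed]
  consider "s = e" "t = e" "u = e" | "s = e" "t = e" "u \<noteq> e" | "s \<noteq> e" "t = e" "u = e"
    | "s = e" "t \<noteq> e" "u \<noteq> e" | "s \<noteq> e" "t \<noteq> e" "u = e" | "s \<noteq> e" "t \<noteq> e" "u \<noteq> e"
    using t by blast
  then show ?thesis
  proof cases
    case 1
    then show ?thesis using braid[of i j k] I by (simp add: S_def)
  next
    case 2
    have "inv (P k j) \<otimes> (P i k \<otimes> P i j) = (P i j \<otimes> P i k) \<otimes> inv (P k j)"
      using braid[of i k j] I U c by (intro Units_inv_shift) (auto simp: m_assoc)
    then show ?thesis using 2 c by (simp add: S_def m_assoc)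
  next
    case 3
    have "inv (P j i) \<otimes> (P i k \<otimes> P j k) = (P j k \<otimes> P i k) \<otimes> inv (P j i)"
      using braid[of j i k] I U c by (intro Units_inv_shift) (auto simp: m_assoc)
    then show ?thesis using 3 c by (simp add: S_def m_assoc)
  next
    case 4
    have "inv (P k i \<otimes> P k j) \<otimes> P i j = P i j \<otimes> inv (P k j \<otimes> P k i)"
      using braid[of k i j] I U c by (intro Units_inv_intertwine) (auto simp: m_assoc)
    then show ?thesis using 4 U c by (simp add: S_def m_assoc Units_inv_mult)
  next
    case 5
    have "inv (P k i \<otimes> P j i) \<otimes> P j k = P j k \<otimes> inv (P j i \<otimes> P k i)"
      using braid[of j k i] I U c by (intro Units_inv_intertwine) (auto simp: m_assoc)
    then show ?thesis using 5 U c by (simp add: S_def m_assoc Units_inv_mult)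
  next
    case 6
    have "inv (P k j \<otimes> P k i \<otimes> P j i) = inv (P j i \<otimes> P k i \<otimes> P k j)"
      using I by (intro arg_cong[where f = "m_inv G"] braid) auto
    then show ?thesis using 6 U c by (simp add: S_def m_assoc Units_inv_mult)
  qed
qed

end

section \<open>R-matrices in completed tensor powers\<close>

context completed_tensor_powers
begin

section \<open>Leg embeddings of \<open>R\<close> and of its signed versions\<close>

lemma ring_completion: "ring (A m)"
  using completion_algebra[of m] by (simp add: assoc_algebra_def)

lemma leg_ring_hom: "is_leg p \<sigma> \<Longrightarrow> length \<sigma> = m \<Longrightarrow> leg p \<sigma> \<in> ring_hom (A m) (A p)"
  using leg_hom[of p \<sigma>] by (auto simp: alg_hom_def)

lemma leg_Units:
  "is_leg p \<sigma> \<Longrightarrow> length \<sigma> = m \<Longrightarrow> x \<in> Units (A m) \<Longrightarrow> leg p \<sigma> x \<in> Units (A p)"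
  by (rule ring_hom_Units(1)[OF leg_ring_hom ring_completion ring_completion])

lemma leg_pair_ring_hom: "is_leg p [i, j] \<Longrightarrow> leg p [i, j] \<in> ring_hom (A 2) (A p)"
  by (rule leg_ring_hom) simp_all

lemma leg_pair_Units: "is_leg p [i, j] \<Longrightarrow> x \<in> Units (A 2) \<Longrightarrow> leg p [i, j] x \<in> Units (A p)"
  by (rule leg_Units) simp_all

lemma leg_comp_pair:
  assumes "is_leg p [i, j]" "is_leg q \<rho>" "length \<rho> = p" "x \<in> carrier (A 2)"
  shows "leg q \<rho> (leg p [i, j] x) = leg q [\<rho> ! (i - 1), \<rho> ! (j - 1)] x"
  using leg_comp[OF assms(1-3), of x] assms(4) by (simp add: numeral_2_eq_2)

text \<open>Homomorphisms preserve inverses, and composing with the flip exchanges the two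
  positions. This is the shape of \<open>S\<close> in \<open>signed_braid_equation\<close>, with the
  sign \<open>1\<close> as \<open>e\<close>.\<close>

lemma leg_pair_signed_R:
  assumes R: "R \<in> Units (A 2)" and ij: "is_leg p [i, j]"
  shows "leg p [i, j] (signed_R R s) =
    (if s = 1 then leg p [i, j] R else inv\<^bsub>A p\<^esub> (leg p [j, i] R))"
proof -
  interpret A2: ring "A 2" by (rule ring_completion)
  have flip: "is_leg 2 [2, 1]" by (simp add: is_leg_def)
  have "leg p [i, j] (inv\<^bsub>A 2\<^esub> (leg 2 [2, 1] R)) = inv\<^bsub>A p\<^esub> (leg p [i, j] (leg 2 [2, 1] R))"
    by (rule ring_hom_Units(2)[OF leg_pair_ring_hom ring_completion ring_completion])
      (use ij R leg_pair_Units[OF flip] in auto)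
  also have "leg p [i, j] (leg 2 [2, 1] R) = leg p [j, i] R"
    using leg_comp_pair[OF flip ij] R by auto
  finally show ?thesis by (simp add: signed_R_def)
qed

lemma signed_R_closed:
  assumes "R \<in> Units (A 2)"
  shows "signed_R R s \<in> carrier (A 2)"
proof -
  interpret A2: ring "A 2" by (rule ring_completion)
  show ?thesis
    using assms leg_pair_Units[of 2 2 1 R] by (auto simp: signed_R_def is_leg_def)
qed

lemma leg_signed_R_closed:
  assumes "R \<in> Units (A 2)" "is_leg p [i, j]"
  shows "leg p [i, j] (signed_R R s) \<in> carrier (A p)"
  using ring_hom_closed[OF leg_pair_ring_hom] assms signed_R_closed by blast

section \<open>The Yang-Baxter equation for \<open>R\<close> and for its signed versions\<close>

text \<open>Flipping the first two legs of \<open>cop 2 1 R\<close>, which is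
  \<open>R_{1,3} R_{2,3}\<close>, exchanges its factors; by the R-matrix property the same flip is
  conjugation by \<open>R_{1,2}\<close>. Comparing the two gives the equation.\<close>

lemma R_matrix_QYBE:
  assumes "R_matrix R"
  shows "leg 3 [1, 2] R \<otimes>\<^bsub>A 3\<^esub> leg 3 [1, 3] R \<otimes>\<^bsub>A 3\<^esub> leg 3 [2, 3] R =
    leg 3 [2, 3] R \<otimes>\<^bsub>A 3\<^esub> leg 3 [1, 3] R \<otimes>\<^bsub>A 3\<^esub> leg 3 [1, 2] R"
proof -
  interpret A2: ring "A 2" by (rule ring_completion)
  interpret A3: ring "A 3" by (rule ring_completion)
  have R: "R \<in> Units (A 2)" and cop: "cop 2 1 R = leg 3 [1, 3] R \<otimes>\<^bsub>A 3\<^esub> leg 3 [2, 3] R"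
    and conj: "\<forall>h\<in>carrier H.
      leg 2 [2, 1] (inc 2 (\<Delta> h)) = R \<otimes>\<^bsub>A 2\<^esub> inc 2 (\<Delta> h) \<otimes>\<^bsub>A 2\<^esub> inv\<^bsub>A 2\<^esub> R"
    using assms by (simp_all add: R_matrix_def)
  have legs: "is_leg 3 [1, 2]" "is_leg 3 [1, 3]" "is_leg 3 [2, 3]" "is_leg 3 [2, 1, 3]"
    by (simp_all add: is_leg_def)
  have U: "leg 3 [1, 2] R \<in> Units (A 3)" "leg 3 [1, 3] R \<in> Units (A 3)" "leg 3 [2, 3] R \<in> Units (A 3)"
    using R legs by (simp_all add: leg_pair_Units)
  have swap: "leg 3 [2, 1, 3] (leg 3 [1, 3] R) = leg 3 [2, 3] R"
    "leg 3 [2, 1, 3] (leg 3 [2, 3] R) = leg 3 [1, 3] R"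
    using leg_comp_pair[OF legs(2,4), of R] leg_comp_pair[OF legs(3,4), of R] R by auto
  have h: "leg 3 [2, 1, 3] \<in> ring_hom (A 3) (A 3)"
    by (rule leg_ring_hom[OF legs(4)]) simp
  \<comment> \<open>For \<open>i = 1\<close> and \<open>m = 2\<close> the permutation in
    \<open>flip_conjugation\<close> is \<open>[2, 1, 3]\<close>.\<close>
  have "leg 3 [2, 1, 3] (cop 2 1 R) = leg 3 [1, 2] R \<otimes>\<^bsub>A 3\<^esub> cop 2 1 R \<otimes>\<^bsub>A 3\<^esub> inv\<^bsub>A 3\<^esub> (leg 3 [1, 2] R)"
    using flip_conjugation[OF R conj, of 1 2 R] A2.Units_closed[OF R] by (simp add: upt_rec numeral_eq_Suc)
  also have "leg 3 [2, 1, 3] (cop 2 1 R) = leg 3 [2, 3] R \<otimes>\<^bsub>A 3\<^esub> leg 3 [1, 3] R"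
    unfolding cop using U by (simp add: ring_hom_mult[OF h] swap A3.Units_closed del: One_nat_def)
  \<comment> \<open>Both expressions are multiplied by \<open>R_{1,2}\<close> on the right, to
    cancel the inverse.\<close>
  finally have "leg 3 [2, 3] R \<otimes>\<^bsub>A 3\<^esub> leg 3 [1, 3] R \<otimes>\<^bsub>A 3\<^esub> leg 3 [1, 2] R =
      leg 3 [1, 2] R \<otimes>\<^bsub>A 3\<^esub> (leg 3 [1, 3] R \<otimes>\<^bsub>A 3\<^esub> leg 3 [2, 3] R)
        \<otimes>\<^bsub>A 3\<^esub> (inv\<^bsub>A 3\<^esub> (leg 3 [1, 2] R) \<otimes>\<^bsub>A 3\<^esub> leg 3 [1, 2] R)"
    using U by (simp add: cop A3.m_assoc A3.Units_closed del: One_nat_def A3.Units_l_inv)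
  then show ?thesis
    using U by (simp add: A3.m_assoc A3.Units_closed)
qed

text \<open>Image of the equation in \<open>A 3\<close> under the embedding
  \<open>[i, j, k]\<close>. The positions may come in any order, and the sign patterns do call for
  different orders of the same three positions.\<close>

lemma leg_R_braid:
  assumes R: "R_matrix R" and ijk: "{i, j, k} \<subseteq> {1..p}" "distinct [i, j, k]"
  shows "leg p [i, j] R \<otimes>\<^bsub>A p\<^esub> leg p [i, k] R \<otimes>\<^bsub>A p\<^esub> leg p [j, k] R =
    leg p [j, k] R \<otimes>\<^bsub>A p\<^esub> leg p [i, k] R \<otimes>\<^bsub>A p\<^esub> leg p [i, j] R"
proof -
  interpret A2: ring "A 2" by (rule ring_completion)
  interpret A3: ring "A 3" by (rule ring_completion)
  have R2: "R \<in> Units (A 2)" using R by (simp add: R_matrix_def)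
  have legs: "is_leg 3 [1, 2]" "is_leg 3 [1, 3]" "is_leg 3 [2, 3]" and leg_ijk: "is_leg p [i, j, k]"
    using ijk by (simp_all add: is_leg_def)
  have c: "leg 3 [1, 2] R \<in> carrier (A 3)" "leg 3 [1, 3] R \<in> carrier (A 3)" "leg 3 [2, 3] R \<in> carrier (A 3)"
    using R2 legs by (simp_all add: leg_pair_Units A3.Units_closed)
  have comp: "leg p [i, j, k] (leg 3 [1, 2] R) = leg p [i, j] R"
    "leg p [i, j, k] (leg 3 [1, 3] R) = leg p [i, k] R"
    "leg p [i, j, k] (leg 3 [2, 3] R) = leg p [j, k] R"
    using legs[THEN leg_comp_pair[OF _ leg_ijk]] R2 by auto
  have h: "leg p [i, j, k] \<in> ring_hom (A 3) (A p)"
    by (rule leg_ring_hom[OF leg_ijk]) simp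
  show ?thesis
    using arg_cong[OF R_matrix_QYBE[OF R], of "leg p [i, j, k]"] c
    by (simp add: ring_hom_mult[OF h] comp del: One_nat_def)
qed

lemma signed_R_braid:
  assumes R: "R_matrix R" and ijk: "{i, j, k} \<subseteq> {1..p}" "distinct [i, j, k]" and "t \<in> {s, u}"
  shows "leg p [i, j] (signed_R R s) \<otimes>\<^bsub>A p\<^esub> leg p [i, k] (signed_R R t) \<otimes>\<^bsub>A p\<^esub> leg p [j, k] (signed_R R u) =
    leg p [j, k] (signed_R R u) \<otimes>\<^bsub>A p\<^esub> leg p [i, k] (signed_R R t) \<otimes>\<^bsub>A p\<^esub> leg p [i, j] (signed_R R s)"
proof -
  interpret Ap: ring "A p" by (rule ring_completion)
  have R2: "R \<in> Units (A 2)" using R by (simp add: R_matrix_def)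
  have legs: "is_leg p [i, j]" "is_leg p [i, k]" "is_leg p [j, k]"
    using ijk by (auto simp: is_leg_def)
  show ?thesis
    unfolding legs[THEN leg_pair_signed_R[OF R2]]
    by (rule Ap.signed_braid_equation[where P = "\<lambda>i j. leg p [i, j] R" and I = "{1..p}"])
      (use assms R2 leg_R_braid[OF R] in \<open>auto intro!: leg_pair_Units simp: is_leg_def\<close>)
qed

section \<open>Placements of \<open>bold_R\<close> in blocks and their Yang-Baxter equation\<close>

text \<open>The embedding distributes over both layers of products, and legs compose: position
  \<open>i\<close> goes to entry \<open>i\<close> of \<sigma> and position \<open>n + j\<close> to
  entry \<open>j\<close> of \<tau>, counted from 1.\<close>

lemma leg_bold_R:
  assumes R: "R \<in> Units (A 2)" and \<sigma>: "is_leg p (\<sigma> @ \<tau>)" "length \<sigma> = n" "length \<tau> = n"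
  shows "leg p (\<sigma> @ \<tau>) (bold_R n a R) =
    ordered_prod (A p) (map (\<lambda>j. ordered_prod (A p) (map (\<lambda>i.
      leg p [\<sigma> ! (i - 1), \<tau> ! (j - 1)] (signed_R R (a j i))) [1..<n + 1])) (rev [1..<n + 1]))"
proof -
  interpret A2n: ring "A (2 * n)" by (rule ring_completion)
  have h: "leg p (\<sigma> @ \<tau>) \<in> ring_hom (A (2 * n)) (A p)"
    by (rule leg_ring_hom) (use \<sigma> in auto)
  have legs: "is_leg (2 * n) [i, n + j]" if "i \<in> {1..n}" "j \<in> {1..n}" for i j
    using that by (auto simp: is_leg_def)
  have carr: "leg (2 * n) [i, n + j] (signed_R R s) \<in> carrier (A (2 * n))"
    if "i \<in> {1..n}" "j \<in> {1..n}" for i j s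
    using that legs R by (intro leg_signed_R_closed)
  have comp: "leg p (\<sigma> @ \<tau>) (leg (2 * n) [i, n + j] (signed_R R s)) =
      leg p [\<sigma> ! (i - 1), \<tau> ! (j - 1)] (signed_R R s)"
    if "i \<in> {1..n}" "j \<in> {1..n}" for i j s
    using leg_comp_pair[OF legs[OF that] \<sigma>(1), of "signed_R R s"] that \<sigma> signed_R_closed[OF R]
    by (auto simp: nth_append)
  have inner: "leg p (\<sigma> @ \<tau>) (ordered_prod (A (2 * n)) (map (\<lambda>i.
        leg (2 * n) [i, n + j] (signed_R R (a j i))) [1..<n + 1])) =
      ordered_prod (A p) (map (\<lambda>i. leg p [\<sigma> ! (i - 1), \<tau> ! (j - 1)] (signed_R R (a j i))) [1..<n + 1])"
    if j: "j \<in> {1..n}" for j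
    by (subst ring_hom_ordered_prod[OF h ring_completion])
      (use j carr comp in \<open>auto simp del: upt_Suc intro!: arg_cong[where f = "ordered_prod (A p)"]\<close>)
  show ?thesis
    unfolding bold_R_def
    by (subst ring_hom_ordered_prod[OF h ring_completion])
      (use inner carr in \<open>auto simp del: upt_Suc intro!: arg_cong[where f = "ordered_prod (A p)"] A2n.ordered_prod_closed\<close>)
qed

lemma bold_R_closed:
  assumes "R \<in> Units (A 2)"
  shows "bold_R n a R \<in> carrier (A (2 * n))"
proof -
  interpret A2n: ring "A (2 * n)" by (rule ring_completion)
  have "leg (2 * n) [i, n + j] (signed_R R s) \<in> carrier (A (2 * n))"
    if "i \<in> {1..n}" "j \<in> {1..n}" for i j s
    using that assms by (intro leg_signed_R_closed) (auto simp: is_leg_def)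
  then show ?thesis
    unfolding bold_R_def
    by (intro A2n.ordered_prod_closed) (auto simp del: upt_Suc intro!: A2n.ordered_prod_closed)
qed

lemma leg_block_bold_R:
  assumes R: "R \<in> Units (A 2)" and bc: "(b, c) \<in> {(1, 2), (1, 3), (2, 3)}"
  shows "leg (3 * n) (block n b @ block n c) (bold_R n a R) =
    ordered_prod (A (3 * n)) (map (\<lambda>j. ordered_prod (A (3 * n)) (map (\<lambda>i.
      leg (3 * n) [(b - 1) * n + i, (c - 1) * n + j] (signed_R R (a j i))) [1..<n + 1])) (rev [1..<n + 1]))"
proof -
  \<comment> \<open>With numerals for \<open>b\<close> and \<open>c\<close>, the bounds and the
    disjointness of the blocks are linear in \<open>n\<close>.\<close>
  have b_cases: "b = 1 \<and> c = 2 \<or> b = 1 \<and> c = 3 \<or> b = 2 \<and> c = 3" using bc by auto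
  have "is_leg (3 * n) (block n b @ block n c)"
    using b_cases by (auto simp: is_leg_def block_def simp del: upt_Suc)
  moreover have "length (block n b) = n" "length (block n c) = n"
    using b_cases by (auto simp: block_def)
  ultimately show ?thesis
    by (subst leg_bold_R[OF R])
      (use b_cases in \<open>auto simp: block_def nth_append simp del: upt_Suc intro!: arg_cong[where f = "ordered_prod (A (3 * n))"]\<close>)
qed

text \<open>\<open>block_braid_equation\<close> applies with \<open>is\<close> and \<open>js\<close>
  increasing and \<open>ks\<close> decreasing: the index of the second block decreases in the
  placement in blocks 1, 2 and increases inside the one in blocks 2, 3.\<close>

theorem bold_R_solves_QYBE:
  assumes R: "R_matrix R" and a: "transitive_matrix n a"
  shows "solves_QYBE n (bold_R n a R)"
proof -
  interpret A3n: ring "A (3 * n)" by (rule ring_completion)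
  have R2: "R \<in> Units (A 2)" using R by (simp add: R_matrix_def)
  have comm: "leg (3 * n) [i, j] (signed_R R s) \<otimes>\<^bsub>A (3 * n)\<^esub> leg (3 * n) [k, l] (signed_R R t) =
      leg (3 * n) [k, l] (signed_R R t) \<otimes>\<^bsub>A (3 * n)\<^esub> leg (3 * n) [i, j] (signed_R R s)"
    if "{i, j, k, l} \<subseteq> {1..3 * n}" "distinct [i, j, k, l]" for i j k l s t
    using that signed_R_closed[OF R2]
    by (intro leg_commute) (auto simp: is_leg_def numeral_2_eq_2)
  have blocks: "(1, 2) \<in> {(1, 2), (1, 3), (2 :: nat, 3 :: nat)}" "(1, 3) \<in> {(1, 2), (1, 3), (2 :: nat, 3 :: nat)}"
    "(2, 3) \<in> {(1, 2), (1, 3), (2 :: nat, 3 :: nat)}"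
    by simp_all
  \<comment> \<open>The signs at the legs of \<open>i\<close>, \<open>j\<close>, \<open>k\<close> in
    blocks 1, 2, 3 are \<open>a j i\<close>, \<open>a k i\<close>, \<open>a k j\<close>, so
    transitivity is read along \<open>k\<close>, \<open>j\<close>, \<open>i\<close>.\<close>
  have sign: "a k i \<in> {a j i, a k j}" if "i \<in> {1..n}" "j \<in> {1..n}" "k \<in> {1..n}" for i j k
    using a that unfolding transitive_matrix_def by blast
  have "leg (3 * n) (block n 1 @ block n 2) (bold_R n a R)
      \<otimes>\<^bsub>A (3 * n)\<^esub> leg (3 * n) (block n 1 @ block n 3) (bold_R n a R)
      \<otimes>\<^bsub>A (3 * n)\<^esub> leg (3 * n) (block n 2 @ block n 3) (bold_R n a R) =
    leg (3 * n) (block n 2 @ block n 3) (bold_R n a R)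
      \<otimes>\<^bsub>A (3 * n)\<^esub> leg (3 * n) (block n 1 @ block n 3) (bold_R n a R)
      \<otimes>\<^bsub>A (3 * n)\<^esub> leg (3 * n) (block n 1 @ block n 2) (bold_R n a R)"
    unfolding blocks[THEN leg_block_bold_R[OF R2]]
  proof (rule A3n.block_braid_equation, goal_cases)
    \<comment> \<open>The braid equation for single legs, at the positions \<open>i\<close>,
      \<open>n + j\<close>, \<open>2 * n + k\<close>; the other goals concern distinctness, closure
      and commutation of disjoint legs.\<close>
    case (7 i j k)
    then have "i \<in> {1..n}" "j \<in> {1..n}" "k \<in> {1..n}" by auto
    then show ?case
      using sign by (intro signed_R_braid[OF R]) auto
  qed (auto intro!: leg_signed_R_closed[OF R2] comm simp: is_leg_def simp del: upt_Suc)
  then show ?thesis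
    unfolding solves_QYBE_def Let_def using bold_R_closed[OF R2] by blast
qed

end

theorem proposition5p6:
  fixes K :: "('k, 'r) ring_scheme"
    and H :: "('k, 'h, 's) module_scheme"
    and \<Delta> :: "'h \<Rightarrow> ('h list \<Rightarrow> 'k) set"
    and \<epsilon> :: "'h \<Rightarrow> 'k"
    and A :: "nat \<Rightarrow> ('k, 'a, 't) module_scheme"
    and inc :: "nat \<Rightarrow> ('h list \<Rightarrow> 'k) set \<Rightarrow> 'a"
    and leg :: "nat \<Rightarrow> nat list \<Rightarrow> 'a \<Rightarrow> 'a"
    and cop cou :: "nat \<Rightarrow> nat \<Rightarrow> 'a \<Rightarrow> 'a"
    and R :: 'a
    and n :: nat
    and a :: "nat \<Rightarrow> nat \<Rightarrow> int"
  assumes "completed_tensor_powers K H \<Delta> \<epsilon> A inc leg cop cou"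
    and "completed_tensor_powers.R_matrix H \<Delta> A inc leg cop R"
    and "\<And>i j. i \<in> {1..n} \<Longrightarrow> j \<in> {1..n} \<Longrightarrow> a i j \<in> {1, -1}"
    and "transitive_matrix n a"
    and "\<And>i j. 1 \<le> i \<Longrightarrow> i < j \<Longrightarrow> j \<le> n \<Longrightarrow> a j i = - a i j"
  shows "completed_tensor_powers.solves_QYBE A leg n
    (completed_tensor_powers.bold_R A leg n a R)"
  by (rule completed_tensor_powers.bold_R_solves_QYBE[OF assms(1,2,4)])

end
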